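(* Fix $p\in[0,1]$. For $n\ge 4$ let $\vec G(n,p)$ be the random directed graph on $[n]$ obtained by including each of the $\binom n2$ edges independently with probability $p$ and then orienting each included edge independently in either direction with probability $1/2$. Let $a,s,b,t$ be four distinct fixed vertices, $A$ the event that there is no directed path from $s$ to $a$, and $B$ the event that there is no directed path from $t$ to $b$. Then $$\lim_{n\to\infty}\frac{\mathbb{P}(A\cap B)-\mathbb{P}(A)\mathbb{P}(B)}{\mathbb{P}(A\cap B)}=\frac{p(3-p)}{4-p}.$$
   Context: Probabilities are taken in the joint probability space of the random graph and the random orientations (the "annealed" model). *)

theory Defs
  imports "HOL-Probability.Probability" "Graph_Theory.Graph_Theory"
begin

(* The undirected edge between u and v is encoded as the pair (u, v) with u < v. *)
definition edges :: "nat \<Rightarrow> (nat \<times> nat) set" where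
  "edges n = {(u, v). 1 \<le> u \<and> u < v \<and> v \<le> n}"

(* The edge set of G(n,p). *)
definition gnp_pmf :: "nat \<Rightarrow> real \<Rightarrow> (nat \<times> nat) set pmf" where
  "gnp_pmf n p =
     map_pmf (\<lambda>present. {e \<in> edges n. present e})
       (Pi_pmf (edges n) False (\<lambda>_. bernoulli_pmf p))"

(* A fair coin for each edge (u, v) of E decides between the arcs (u, v) and (v, u). *)
definition orientation_pmf :: "(nat \<times> nat) set \<Rightarrow> (nat \<times> nat) set pmf" where
  "orientation_pmf E =
     map_pmf (\<lambda>keep. (\<lambda>(u, v). if keep (u, v) then (u, v) else (v, u)) ` E)
       (Pi_pmf E False (\<lambda>_. bernoulli_pmf (1/2)))"

(* The annealed model: the law of the oriented graph, averaged over both the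
   graph and the orientation. *)
definition random_digraph_pmf :: "nat \<Rightarrow> real \<Rightarrow> nat pair_pre_digraph pmf" where
  "random_digraph_pmf n p =
     do {
       E \<leftarrow> gnp_pmf n p;
       R \<leftarrow> orientation_pmf E;
       return_pmf \<lparr> pverts = {1..n}, parcs = R \<rparr>
     }"

definition no_dipath :: "'a \<Rightarrow> 'a \<Rightarrow> 'a pair_pre_digraph set" where
  "no_dipath u v = {D. \<nexists>q. pre_digraph.apath (with_proj D) u q v}"

end

theory Submission
  imports Defs "HOL-Real_Asymp.Real_Asymp"
begin

text \<open>
  For $p = 0$ both paths are a.s. absent. For $p > 0$ write $q = 1 - p/2 < 1$ for the probability that a given arc is absent.  There is no path from $s$ to
  $a$ iff some vertex set containing $s$ but not $a$ has no exiting arc.  A fixed arc set $F$ is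
  avoided with probability at most $q^{|F|}$, and exactly $q^{|F|}$ if $F$ contains no two opposite
  arcs.  Hence, up to $o(q^n)$, the event $A$ means that $\{s\}$ or the complement of $\{a\}$ has no exit, so
  $P(A) \sim 2 q^{n-1}$.  For $A \cap B$ the union bound shows that, up to $o(q^{2n})$, only sets with
  at most two or at least $n-2$ vertices matter.  Since exitless sets are stable under unions and
  intersections, $A \cap B$ is then the disjoint union of four events: $\{s,t\}$ has no exit; $\{a,b\}$
  has no entry; $\{s\}$ has no exit and $\{b\}$ no entry; $\{t\}$ has no exit and $\{a\}$ no entry.
  The arcs inside $\{s,t\}$ or $\{a,b\}$ are free, and $s \to b$ (or $t \to a$) is counted only once, so
  $P(A \cap B) \sim 2 q^{2n-4} + 2 q^{2n-3}$.  The limit is therefore $1 - 2 q^2 / (1 + q)$.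
\<close>

section \<open>Probability that the random digraph avoids a given set of arcs\<close>

lemma finite_edges: "finite (edges n)"
  by (rule finite_subset[of _ "{1..n} \<times> {1..n}"]) (auto simp: edges_def)

definition avoiding :: "('a \<times> 'a) set \<Rightarrow> 'a pair_pre_digraph set" where
  "avoiding F = {D. parcs D \<inter> F = {}}"

text \<open>Counting the forbidden orientations of an edge as 0, 1 or 2 lets one formula,
  \<open>1 - p * num_forbidden F e / 2\<close>, give the probability that the edge contributes no
  forbidden arc.\<close>

definition num_forbidden :: "('a \<times> 'a) set \<Rightarrow> 'a \<times> 'a \<Rightarrow> nat" where
  "num_forbidden F e = of_bool (e \<in> F) + of_bool (prod.swap e \<in> F)"

text \<open>Avoidance restricts each coin separately: \<open>keep\<close> must lie in the product
  set \<open>Pi E B\<close>, where \<open>B e\<close> holds the coin values that give an allowed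
  arc. Independence then turns the probability into a product.\<close>

lemma prob_orientation_avoids:
  fixes E F :: "(nat \<times> nat) set"
  assumes "finite E"
  shows "measure_pmf.prob (orientation_pmf E) {R. R \<inter> F = {}} =
    (\<Prod>e\<in>E. 1 - real (num_forbidden F e) / 2)"
proof -
  define B where "B = (\<lambda>e. {b. (if b then e else prod.swap e) \<notin> F})"
  have B: "measure_pmf.prob (bernoulli_pmf (1/2)) (B e) = 1 - real (num_forbidden F e) / 2" for e
  proof -
    have "B e = (if e \<in> F then {} else {True}) \<union> (if prod.swap e \<in> F then {} else {False})"
      by (auto simp: B_def split: if_splits)
    then show ?thesis
      by (simp add: num_forbidden_def measure_measure_pmf_finite)
  qed
  have "(\<lambda>(u, v). if keep (u, v) then (u, v) else (v, u)) ` E \<inter> F = {} \<longleftrightarrow> keep \<in> Pi E B" for keep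
  proof -
    have "(\<lambda>(u, v). if keep (u, v) then (u, v) else (v, u)) = (\<lambda>e. if keep e then e else prod.swap e)"
      by (auto simp: fun_eq_iff)
    moreover have "f ` E \<inter> F = {} \<longleftrightarrow> (\<forall>e\<in>E. f e \<notin> F)" for f :: "nat \<times> nat \<Rightarrow> nat \<times> nat"
      by blast
    ultimately show ?thesis
      by (simp only: B_def Pi_def) blast
  qed
  then have "(\<lambda>keep. (\<lambda>(u, v). if keep (u, v) then (u, v) else (v, u)) ` E) -` {R. R \<inter> F = {}} = Pi E B"
    by (simp add: vimage_def)
  then show ?thesis
    by (simp add: orientation_pmf_def measure_map_pmf measure_Pi_pmf_Pi assms B)
qed

text \<open>Condition on the undirected graph. An absent edge contributes the factor 1 and a present
  one \<open>g e\<close>, so the product runs over all of \<open>edges n\<close>; independence of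
  the edges moves the expectation inside, and each factor averages to
  \<open>(1 - p) + p * g e\<close>.\<close>

lemma prob_avoiding_prod:
  assumes "p \<in> {0..1}"
  shows "measure_pmf.prob (random_digraph_pmf n p) (avoiding F) =
    (\<Prod>e\<in>edges n. 1 - p * real (num_forbidden F e) / 2)"
proof -
  define g where "g e = 1 - real (num_forbidden F e) / 2" for e
  have g: "g e \<ge> 0" for e by (auto simp: g_def num_forbidden_def)
  define H where "H = Pi_pmf (edges n) False (\<lambda>_. bernoulli_pmf p)"
  have "random_digraph_pmf n p = bind_pmf (gnp_pmf n p)
      (\<lambda>E. map_pmf (\<lambda>R. \<lparr>pverts = {1..n}, parcs = R\<rparr>) (orientation_pmf E))"
    (is "_ = bind_pmf _ ?N")
    by (simp add: random_digraph_pmf_def map_pmf_def)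
  then have "measure_pmf.prob (random_digraph_pmf n p) (avoiding F) =
    measure_pmf.expectation (gnp_pmf n p) (\<lambda>E. measure_pmf.prob (?N E) (avoiding F))"
    by (simp only: measure_pmf_bind)
       (rule measure_pmf.measure_bind[where N = "count_space UNIV"], simp, simp add: measure_pmf_in_subprob_algebra, simp)
  also have "\<dots> =
    measure_pmf.expectation (gnp_pmf n p) (\<lambda>E. measure_pmf.prob (orientation_pmf E) {R. R \<inter> F = {}})"
    by (simp add: avoiding_def vimage_def)
  also have "\<dots> = measure_pmf.expectation H
     (\<lambda>present. measure_pmf.prob (orientation_pmf {e \<in> edges n. present e}) {R. R \<inter> F = {}})"
    by (simp add: gnp_pmf_def H_def)
  also have "\<dots> = measure_pmf.expectation H (\<lambda>present. \<Prod>e\<in>edges n. if present e then g e else 1)"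
    by (simp add: prob_orientation_avoids finite_edges prod.inter_filter flip: g_def)
  also have "\<dots> = (\<Prod>e\<in>edges n. measure_pmf.expectation (bernoulli_pmf p) (\<lambda>b. if b then g e else 1))"
    unfolding H_def
    by (rule expectation_prod_Pi_pmf[where f = "\<lambda>e b. if b then g e else 1"])
       (auto simp: finite_edges g intro: integrable_measure_pmf_finite)
  also have "\<dots> = (\<Prod>e\<in>edges n. 1 - p * real (num_forbidden F e) / 2)"
    using assms by (intro prod.cong) (auto simp: g_def algebra_simps)
  finally show ?thesis .
qed

text \<open>Without loops, each arc of \<open>F\<close> is an orientation of exactly one edge:
  ascending arcs lie in \<open>edges n\<close>, descending ones are swapped into it.\<close>

lemma card_eq_sum_num_forbidden:
  assumes "F \<subseteq> {1..n} \<times> {1..n}" "\<And>v. (v, v) \<notin> F"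
  shows "card F = (\<Sum>e\<in>edges n. num_forbidden F e)"
proof -
  have "(v, u) \<in> edges n \<longleftrightarrow> (u, v) \<notin> edges n" if "(u, v) \<in> F" for u v
    using assms that by (cases u v rule: linorder_cases) (auto simp: edges_def)
  moreover have "(u, v) \<in> prod.swap ` X \<longleftrightarrow> (v, u) \<in> X" for u v :: nat and X
    by force
  ultimately have sw: "prod.swap ` {e \<in> edges n. prod.swap e \<in> F} = F - edges n"
    by auto
  have "card F = card (F \<inter> edges n) + card (F - edges n)"
    by (rule card_Int_Diff) (rule finite_subset[OF assms(1)], simp)
  also have "card (F - edges n) = card {e \<in> edges n. prod.swap e \<in> F}"
    unfolding sw[symmetric] by (rule card_image) simp
  finally show ?thesis
    by (simp add: num_forbidden_def sum.distrib finite_edges of_bool_def flip: sum.inter_filter card_eq_sum)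
       (simp add: Int_def conj_commute)
qed

text \<open>Factorwise comparison for \<open>k = num_forbidden F e\<close> in {0, 1, 2}. Only
  \<open>k = 2\<close> loses anything: opposite arcs exclude each other, so both are avoided with
  probability \<open>1 - p\<close>, which is at most \<open>(1 - p / 2)^2\<close>.\<close>

lemma prob_avoiding_le:
  assumes "p \<in> {0..1}" "F \<subseteq> {1..n} \<times> {1..n}" "\<And>v. (v, v) \<notin> F"
  shows "measure_pmf.prob (random_digraph_pmf n p) (avoiding F) \<le> (1 - p / 2) ^ card F"
proof -
  have "1 - p * real (num_forbidden F e) / 2 \<le> (1 - p / 2) ^ num_forbidden F e" for e
    by (auto simp: num_forbidden_def power2_eq_square field_simps)
  moreover have "0 \<le> 1 - p * real (num_forbidden F e) / 2" for e
    using assms(1) by (auto simp: num_forbidden_def)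
  ultimately show ?thesis
    unfolding prob_avoiding_prod[OF assms(1)] card_eq_sum_num_forbidden[OF assms(2,3)] power_sum
    by (intro prod_mono) auto
qed

text \<open>Now \<open>num_forbidden\<close> is at most 1, so each factor is an exact power.
  Disjointness from the converse also rules out loops, since a loop is its own converse.\<close>

lemma prob_avoiding_eq:
  assumes "p \<in> {0..1}" "F \<subseteq> {1..n} \<times> {1..n}" "F \<inter> F\<inverse> = {}"
  shows "measure_pmf.prob (random_digraph_pmf n p) (avoiding F) = (1 - p / 2) ^ card F"
proof -
  have "1 - p * real (num_forbidden F e) / 2 = (1 - p / 2) ^ num_forbidden F e" for e
    using assms(3) by (cases e) (auto simp: num_forbidden_def)
  moreover have "(v, v) \<notin> F" for v
    using assms(3) by blast
  ultimately show ?thesis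
    unfolding prob_avoiding_prod[OF assms(1)] card_eq_sum_num_forbidden[OF assms(2)] power_sum
    using card_eq_sum_num_forbidden[OF assms(2)] by (simp add: power_sum)
qed

section \<open>Elementary estimates\<close>

text \<open>The concave function \<open>k * (n - k)\<close> is smallest at the ends of the interval
  from \<open>m\<close> to \<open>n - m\<close>; with \<open>i\<close> and \<open>j\<close> as in
  the proof the difference of the two sides is \<open>i * j\<close>.\<close>

lemma mult_diff_mono:
  fixes k m n :: nat
  assumes "m \<le> k" "k \<le> n - m" "m \<le> n"
  shows "m * (n - m) \<le> k * (n - k)"
proof -
  obtain i where i: "k = m + i" using assms(1) le_Suc_ex by blast
  obtain j where j: "n - m = k + j" using assms(2) le_Suc_ex by blast
  have "n - k = m + j" using i j assms(3) by linarith
  then show ?thesis by (simp add: i j algebra_simps)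
qed

lemma tendsto_poly_times_geometric:
  fixes q :: real
  assumes "0 < q" "q < 1"
  shows "(\<lambda>n. real n ^ k * q ^ n) \<longlonglongrightarrow> 0"
  using assms by real_asymp

lemma tendsto_poly_times_geometric':
  fixes q :: real
  assumes "0 < q" "q < 1"
  shows "(\<lambda>n. (real n + 1) * (real n ^ k * q ^ n)) \<longlonglongrightarrow> 0"
  using assms by real_asymp

text \<open>Transfers an exact decomposition of \<open>A\<close> into disjoint events, valid off a
  rare event \<open>N\<close>, to probabilities. On \<open>N\<close> the two integrands differ by at
  most \<open>length Es\<close>; the list is nonempty because \<open>A\<close> alone may contribute
  1 there.\<close>

lemma prob_approx_sum_list:
  assumes "Es \<noteq> []"
    and "\<And>x. x \<in> set_pmf M \<Longrightarrow> x \<notin> N \<Longrightarrow> (indicator A x :: real) = (\<Sum>E\<leftarrow>Es. indicator E x)"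
  shows "\<bar>measure_pmf.prob M A - (\<Sum>E\<leftarrow>Es. measure_pmf.prob M E)\<bar> \<le> real (length Es) * measure_pmf.prob M N"
proof -
  let ?s = "\<lambda>x. (\<Sum>E\<leftarrow>Es. indicator E x) :: real"
  have int: "integrable M (\<lambda>x. (\<Sum>E\<leftarrow>Fs. indicator E x) :: real)"
    "measure_pmf.expectation M (\<lambda>x. \<Sum>E\<leftarrow>Fs. indicator E x) = (\<Sum>E\<leftarrow>Fs. measure_pmf.prob M E)" for Fs
    by (induction Fs) (auto simp: measure_pmf.emeasure_eq_measure)
  have s: "0 \<le> ?s x" "?s x \<le> real (length Es)" for x
    using sum_list_mono[of Es "\<lambda>_. 0" "\<lambda>E. indicator E x :: real"]
      sum_list_mono[of Es "\<lambda>E. indicator E x :: real" "\<lambda>_. 1"]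
    by (auto simp: sum_list_triv indicator_def)
  have len: "1 \<le> real (length Es)"
    using assms(1) by (cases Es) auto
  have *: "\<bar>indicator A x - ?s x\<bar> \<le> real (length Es) * indicator N x" if "x \<in> set_pmf M" for x
    using s[of x] len assms(2)[OF that] by (cases "x \<in> N") (auto simp: indicator_def)
  have "measure_pmf.prob M A - (\<Sum>E\<leftarrow>Es. measure_pmf.prob M E) =
      measure_pmf.expectation M (\<lambda>x. indicator A x - ?s x)"
    using int by (subst Bochner_Integration.integral_diff) (auto simp: measure_pmf.emeasure_eq_measure)
  also have "\<bar>\<dots>\<bar> \<le> measure_pmf.expectation M (\<lambda>x. \<bar>indicator A x - ?s x\<bar>)"
    by (rule integral_abs_bound)
  also have "\<dots> \<le> measure_pmf.expectation M (\<lambda>x. real (length Es) * indicator N x)"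
    using int * by (intro integral_mono_AE integrable_abs Bochner_Integration.integrable_diff)
      (auto simp: measure_pmf.emeasure_eq_measure AE_measure_pmf_iff)
  finally show ?thesis by simp
qed

section \<open>Exitless vertex sets and directed paths\<close>

definition no_exit :: "nat \<Rightarrow> nat set \<Rightarrow> nat pair_pre_digraph set" where
  "no_exit n S = {D. parcs D \<inter> S \<times> ({1..n} - S) = {}}"

lemma set_random_digraph_pmf:
  assumes "D \<in> set_pmf (random_digraph_pmf n p)"
  shows "pverts D = {1..n}" "parcs D \<subseteq> {1..n} \<times> {1..n}"
proof -
  obtain E R where ER: "E \<in> set_pmf (gnp_pmf n p)" "R \<in> set_pmf (orientation_pmf E)"
    and D: "D = \<lparr>pverts = {1..n}, parcs = R\<rparr>"
    using assms by (auto simp: random_digraph_pmf_def)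
  have "E \<subseteq> edges n"
    using ER(1) by (auto simp: gnp_pmf_def)
  then have "R \<subseteq> {1..n} \<times> {1..n}"
    using ER(2) by (fastforce simp: orientation_pmf_def edges_def split: if_splits)
  with D show "pverts D = {1..n}" "parcs D \<subseteq> {1..n} \<times> {1..n}"
    by auto
qed

text \<open>The set of vertices reachable from \<open>u\<close> has no exit; conversely a walk that
  starts in an exitless set never leaves it.\<close>

lemma no_dipath_iff_no_exit:
  assumes "pverts D = {1..n}" "parcs D \<subseteq> {1..n} \<times> {1..n}" "u \<in> {1..n}"
  shows "D \<in> no_dipath u v \<longleftrightarrow> (\<exists>S \<subseteq> {1..n}. u \<in> S \<and> v \<notin> S \<and> D \<in> no_exit n S)"
proof -
  interpret pair_wf_digraph D
    using assms by unfold_locales auto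
  have reach: "D \<in> no_dipath u v \<longleftrightarrow> \<not> u \<rightarrow>\<^sup>*\<^bsub>with_proj D\<^esub> v"
    by (simp add: no_dipath_def reachable_apath)
  show ?thesis
  proof
    assume "D \<in> no_dipath u v"
    moreover have "D \<in> no_exit n {w. u \<rightarrow>\<^sup>*\<^bsub>with_proj D\<^esub> w}"
      by (auto simp: no_exit_def dest: reachable_adj_trans)
    moreover have "{w. u \<rightarrow>\<^sup>*\<^bsub>with_proj D\<^esub> w} \<subseteq> {1..n}"
      using reachable_in_verts(2) assms by auto
    moreover have "u \<rightarrow>\<^sup>*\<^bsub>with_proj D\<^esub> u"
      using assms by (auto intro: reachable_refl)
    ultimately show "\<exists>S \<subseteq> {1..n}. u \<in> S \<and> v \<notin> S \<and> D \<in> no_exit n S"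
      using reach by (intro exI[of _ "{w. u \<rightarrow>\<^sup>*\<^bsub>with_proj D\<^esub> w}"]) simp
  next
    assume "\<exists>S \<subseteq> {1..n}. u \<in> S \<and> v \<notin> S \<and> D \<in> no_exit n S"
    then obtain S where S: "S \<subseteq> {1..n}" "u \<in> S" "v \<notin> S" "D \<in> no_exit n S"
      by blast
    have "w \<in> S" if "u \<rightarrow>\<^sup>*\<^bsub>with_proj D\<^esub> w" for w
      using that
    proof (induction rule: reachable_induct)
      case (step x y)
      then have "(x, y) \<in> parcs D" by simp
      with step S(4) assms(2) show ?case by (auto simp: no_exit_def)
    qed (rule S(2))
    with S(3) reach show "D \<in> no_dipath u v" by blast
  qed
qed

lemma no_exit_Un:
  "D \<in> no_exit n S \<Longrightarrow> D \<in> no_exit n T \<Longrightarrow> D \<in> no_exit n (S \<union> T)"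
  by (auto simp: no_exit_def)

lemma no_exit_Int:
  "D \<in> no_exit n S \<Longrightarrow> D \<in> no_exit n T \<Longrightarrow> S \<subseteq> {1..n} \<Longrightarrow> T \<subseteq> {1..n} \<Longrightarrow> D \<in> no_exit n (S \<inter> T)"
  by (auto simp: no_exit_def)

lemma no_exit_eq_avoiding: "no_exit n S = avoiding (S \<times> ({1..n} - S))"
  by (simp add: no_exit_def avoiding_def)

lemma card_compl: "S \<subseteq> {Suc 0..n} \<Longrightarrow> card ({Suc 0..n} - S) = n - card S"
  by (simp add: card_Diff_subset finite_subset)

text \<open>All arcs of a cut point from \<open>S\<close> outwards, so no two are opposite and the
  exact formula applies.\<close>

lemma prob_no_exit:
  assumes "p \<in> {0..1}" "S \<subseteq> {1..n}"
  shows "measure_pmf.prob (random_digraph_pmf n p) (no_exit n S) = (1 - p / 2) ^ (card S * (n - card S))"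
  unfolding no_exit_eq_avoiding using assms
  by (subst prob_avoiding_eq) (auto simp: card_cartesian_product card_compl)

lemma no_exit_Int_compl:
  assumes "T \<subseteq> {1..n}"
  shows "no_exit n S \<inter> no_exit n ({1..n} - T) = avoiding (S \<times> ({1..n} - S) \<union> ({1..n} - T) \<times> T)"
  using assms by (simp add: no_exit_eq_avoiding double_diff) (auto simp: avoiding_def)

text \<open>The exits of \<open>S\<close> and the entries of \<open>T\<close> share only arcs in
  \<open>S \<times> T\<close>. When \<open>S\<close> and \<open>T\<close> meet, the union may
  contain opposite arcs, so the upper bound for avoidance is used.\<close>

lemma prob_no_exit_Int_no_exit_le:
  assumes "p \<in> {0..1}" "S \<subseteq> {1..n}" "T \<subseteq> {1..n}"
  shows "measure_pmf.prob (random_digraph_pmf n p) (no_exit n S \<inter> no_exit n ({1..n} - T))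
    \<le> (1 - p / 2) ^ (card S * (n - card S) + card T * (n - card T) - card S * card T)"
proof -
  let ?V = "{1..n}"
  let ?F = "S \<times> (?V - S)" and ?G = "(?V - T) \<times> T"
  have fin: "finite S" "finite T"
    using assms finite_subset by blast+
  have eq: "no_exit n S \<inter> no_exit n (?V - T) = avoiding (?F \<union> ?G)"
    using assms(3) by (rule no_exit_Int_compl)
  have "card ?F + card ?G = card (?F \<union> ?G) + card (?F \<inter> ?G)"
    using fin by (intro card_Un_Int) auto
  moreover have "card (?F \<inter> ?G) \<le> card (S \<times> T)"
    using fin by (intro card_mono) auto
  ultimately have "card S * (n - card S) + card T * (n - card T) - card S * card T \<le> card (?F \<union> ?G)"
    using assms by (simp add: card_cartesian_product card_compl mult.commute)
  moreover have "measure_pmf.prob (random_digraph_pmf n p) (avoiding (?F \<union> ?G)) \<le> (1 - p / 2) ^ card (?F \<union> ?G)"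
    using assms by (intro prob_avoiding_le) auto
  ultimately show ?thesis
    unfolding eq using assms(1) by (elim order_trans) (intro power_decreasing, auto)
qed

text \<open>The exits of \<open>u\<close> and the entries of \<open>v\<close> share exactly the arc
  \<open>(u, v)\<close>, which leaves \<open>2 * (n - 1) - 1\<close> arcs, no two of them
  opposite.\<close>

lemma prob_sink_source:
  assumes "p \<in> {0..1}" "u \<in> {1..n}" "v \<in> {1..n}" "u \<noteq> v"
  shows "measure_pmf.prob (random_digraph_pmf n p) (no_exit n {u} \<inter> no_exit n ({1..n} - {v}))
    = (1 - p / 2) ^ (2 * n - 3)"
proof -
  let ?V = "{1..n}"
  let ?F = "{u} \<times> (?V - {u})" and ?G = "(?V - {v}) \<times> {v}"
  have eq: "no_exit n {u} \<inter> no_exit n (?V - {v}) = avoiding (?F \<union> ?G)"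
    using assms(3) by (intro no_exit_Int_compl) simp
  have "card ?F + card ?G = card (?F \<union> ?G) + card (?F \<inter> ?G)"
    by (intro card_Un_Int) auto
  moreover have "?F \<inter> ?G = {(u, v)}"
    using assms by auto
  ultimately have "card (?F \<union> ?G) = 2 * n - 3"
    using assms by (simp add: card_cartesian_product card_compl)
  moreover have "?F \<union> ?G \<subseteq> ?V \<times> ?V" "(?F \<union> ?G) \<inter> (?F \<union> ?G)\<inverse> = {}"
    using assms by auto
  ultimately show ?thesis
    unfolding eq by (simp only: prob_avoiding_eq[OF assms(1)])
qed

section \<open>Union bound over cuts with both sides large\<close>

definition cuts :: "nat \<Rightarrow> nat \<Rightarrow> nat set set" where
  "cuts m n = {S. S \<subseteq> {1..n} \<and> m \<le> card S \<and> card S + m \<le> n}"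

lemma finite_cuts: "finite (cuts m n)"
  by (rule finite_subset[of _ "Pow {1..n}"]) (auto simp: cuts_def)

text \<open>For \<open>q = 1 - p / 2\<close> this is the union bound on the probability that some
  set in \<open>cuts m n\<close> has no exit.\<close>

definition cut_weight :: "real \<Rightarrow> nat \<Rightarrow> nat \<Rightarrow> real" where
  "cut_weight q m n = (\<Sum>S\<in>cuts m n. q ^ (card S * (n - card S)))"

lemma prob_Union_cuts_le:
  assumes "p \<in> {0..1}"
  shows "measure_pmf.prob (random_digraph_pmf n p) (\<Union>S\<in>cuts m n. no_exit n S) \<le> cut_weight (1 - p / 2) m n"
proof -
  have "measure_pmf.prob (random_digraph_pmf n p) (\<Union>S\<in>cuts m n. no_exit n S)
      \<le> (\<Sum>S\<in>cuts m n. measure_pmf.prob (random_digraph_pmf n p) (no_exit n S))"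
    by (intro measure_pmf.finite_measure_subadditive_finite finite_cuts) auto
  also have "\<dots> = cut_weight (1 - p / 2) m n"
    unfolding cut_weight_def using assms by (intro sum.cong prob_no_exit) (auto simp: cuts_def)
  finally show ?thesis .
qed

text \<open>
  For fewer than $K$ or more than $n - K$ vertices there are at most $n^K$ sets of each size; for all
  other sizes the trivial bound $2^n$ on their number suffices once $K$ is large.
\<close>

lemma cut_weight_le:
  assumes q: "0 < q" "q \<le> 1" and n: "m \<le> n" "K \<le> n"
  shows "cut_weight q m n \<le> (real n + 1) * (real n ^ K * q ^ (m * (n - m)) + 2 ^ n * q ^ (K * (n - K)))"
proof -
  let ?b = "real n ^ K * q ^ (m * (n - m)) + 2 ^ n * q ^ (K * (n - K))"
  have level: "(\<Sum>S | S \<in> cuts m n \<and> card S = k. q ^ (card S * (n - card S))) \<le> ?b" if "k \<le> n" for k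
  proof (cases "m \<le> k \<and> k + m \<le> n")
    case True
    then have "{S. S \<in> cuts m n \<and> card S = k} = {S. S \<subseteq> {1..n} \<and> card S = k}"
      by (auto simp: cuts_def)
    then have "(\<Sum>S | S \<in> cuts m n \<and> card S = k. q ^ (card S * (n - card S))) = real (n choose k) * q ^ (k * (n - k))"
      by (simp add: n_subsets)
    also have "\<dots> \<le> ?b"
    proof (cases "k < K \<or> n - k < K")
      case True
      have "n choose k \<le> n ^ K"
      proof -
        \<comment> \<open>Applied to whichever of \<open>k\<close> and \<open>n - k\<close> lies
          below \<open>K\<close>, using the symmetry of binomial coefficients.\<close>
        have "n choose j \<le> n ^ K" if "j \<le> n" "j < K" for j
        proof -
          have "n choose j \<le> n ^ j" using that by (intro binomial_le_pow)
          also have "\<dots> \<le> n ^ K" using that n by (intro power_increasing) auto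
          finally show ?thesis .
        qed
        from this[of k] this[of "n - k"] show ?thesis
          using True \<open>k \<le> n\<close> by (auto simp flip: binomial_symmetric)
      qed
      then have "real (n choose k) \<le> real n ^ K"
        by (simp flip: of_nat_power)
      moreover have "q ^ (k * (n - k)) \<le> q ^ (m * (n - m))"
        using q n \<open>m \<le> k \<and> k + m \<le> n\<close> by (intro power_decreasing mult_diff_mono) auto
      ultimately have "real (n choose k) * q ^ (k * (n - k)) \<le> real n ^ K * q ^ (m * (n - m))"
        using q by (intro mult_mono) auto
      then show ?thesis using q by (simp add: add_increasing2)
    next
      case False
      have "real (n choose k) \<le> 2 ^ n"
        using of_nat_mono[OF binomial_le_pow2[of n k], where 'a = real] by simp
      moreover have "q ^ (k * (n - k)) \<le> q ^ (K * (n - K))"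
        using q n False \<open>k \<le> n\<close> by (intro power_decreasing mult_diff_mono) auto
      ultimately have "real (n choose k) * q ^ (k * (n - k)) \<le> 2 ^ n * q ^ (K * (n - K))"
        using q by (intro mult_mono) auto
      then show ?thesis using q by (simp add: add_increasing)
    qed
    finally show ?thesis .
  next
    case False
    then have "{S. S \<in> cuts m n \<and> card S = k} = {}"
      by (auto simp: cuts_def)
    then show ?thesis using q by (simp only: sum.empty) simp
  qed
  have "cut_weight q m n = (\<Sum>k\<le>n. \<Sum>S | S \<in> cuts m n \<and> card S = k. q ^ (card S * (n - card S)))"
    unfolding cut_weight_def by (rule sum.group[symmetric]) (auto simp: finite_cuts cuts_def)
  also have "\<dots> \<le> (\<Sum>k\<le>n. ?b)"
    by (intro sum_mono level) simp
  finally show ?thesis by (simp add: add.commute)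
qed

text \<open>The smallest exponent is \<open>Suc m * (n - Suc m)\<close>, that is
  \<open>m * n + n\<close> up to a constant. Division by \<open>q ^ (m * n)\<close> therefore leaves
  a polynomial times \<open>q ^ n\<close>, plus a tail.\<close>

lemma tendsto_cut_weight:
  assumes q: "0 < q" "q < 1"
  shows "(\<lambda>n. cut_weight q (Suc m) n / q ^ (m * n)) \<longlonglongrightarrow> 0"
proof -
  have pw: "q ^ i = q ^ k / q ^ l" if "i + l = k" for i k l
    using q that by (auto simp: power_add)
  have "(\<lambda>j. 2 * q ^ j) \<longlonglongrightarrow> 2 * 0"
    using q by (intro tendsto_mult tendsto_const LIMSEQ_power_zero) simp
  then have "eventually (\<lambda>j. 2 * q ^ j < 1) sequentially"
    by (rule order_tendstoD) simp
  then obtain j where j: "2 * q ^ j < 1"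
    by (auto simp: eventually_sequentially)
  \<comment> \<open>With this \<open>K\<close> the tail exponent \<open>K * (n - K)\<close> equals
    \<open>m * n + j * n - K * K\<close>, so the count \<open>2 ^ n\<close> is absorbed into
    \<open>(2 * q ^ j) ^ n\<close>, which tends to 0 by the choice of \<open>j\<close>.\<close>
  define K where "K = m + j"
  define h where "h n = ((real n + 1) * (real n ^ K * q ^ n)) / q ^ (Suc m * Suc m)
    + ((real n + 1) * (real n ^ 0 * (2 * q ^ j) ^ n)) / q ^ (K * K)" for n
  have "h \<longlonglongrightarrow> 0 / q ^ (Suc m * Suc m) + 0 / q ^ (K * K)"
    unfolding h_def using q j
    by (intro tendsto_add tendsto_divide tendsto_const tendsto_poly_times_geometric') auto
  then have "h \<longlonglongrightarrow> 0" by simp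
  have le: "cut_weight q (Suc m) n / q ^ (m * n) \<le> h n" if n: "n \<ge> Suc m + K" for n
  proof -
    have "Suc m * (n - Suc m) + Suc m * Suc m = m * n + n"
      using n by (auto simp: algebra_simps dest!: le_Suc_ex)
    from pw[OF this] have 1: "q ^ (Suc m * (n - Suc m)) = q ^ (m * n) * q ^ n / q ^ (Suc m * Suc m)"
      by (simp only: power_add)
    have "K * (n - K) + K * K = m * n + j * n"
      using n by (auto simp: K_def algebra_simps dest!: le_Suc_ex)
    from pw[OF this] have 2: "q ^ (K * (n - K)) = q ^ (m * n) * q ^ (j * n) / q ^ (K * K)"
      by (simp only: power_add)
    have "cut_weight q (Suc m) n \<le>
      (real n + 1) * (real n ^ K * q ^ (Suc m * (n - Suc m)) + 2 ^ n * q ^ (K * (n - K)))"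
      using q n by (intro cut_weight_le) auto
    also have "\<dots> = h n * q ^ (m * n)"
      unfolding 1 2 h_def by (simp add: power_mult_distrib power_mult[of q j n] algebra_simps)
    finally show ?thesis using q by (simp add: field_simps)
  qed
  have nonneg: "0 \<le> cut_weight q (Suc m) n / q ^ (m * n)" for n
    using q by (auto simp: cut_weight_def intro!: divide_nonneg_nonneg sum_nonneg)
  show ?thesis
  proof (rule tendsto_sandwich)
    show "\<forall>\<^sub>F n in sequentially. 0 \<le> cut_weight q (Suc m) n / q ^ (m * n)"
      by (rule always_eventually) (rule allI, rule nonneg)
    show "\<forall>\<^sub>F n in sequentially. cut_weight q (Suc m) n / q ^ (m * n) \<le> h n"
      using le by (rule eventually_sequentiallyI)
  qed (rule tendsto_const, fact)
qed

section \<open>The exceptional event for two pairs of vertices\<close>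

text \<open>
  In a pair $(S, T)$ below, $S$ plays the role of a set without exit and $T$ of a set without entry,
  so that the complement of $T$ has no exit.
\<close>

definition cut_pairs :: "nat \<Rightarrow> (nat set \<times> nat set) set" where
  "cut_pairs n = {(S, T). S \<subseteq> {1..n} \<and> T \<subseteq> {1..n} \<and> card S \<in> {1, 2} \<and> card T \<in> {1, 2} \<and> 3 \<le> card S + card T}"

text \<open>Collects the configurations that force about \<open>3 * n\<close> or more absent arcs
  and are thus negligible against \<open>q ^ (2 * n)\<close>. Off this event the description of the
  double disconnection by four disjoint events is exact.\<close>

definition exceptional :: "nat \<Rightarrow> nat pair_pre_digraph set" where
  "exceptional n = (\<Union>S\<in>cuts 3 n. no_exit n S) \<union>
     (\<Union>(S, T)\<in>cut_pairs n. no_exit n S \<inter> no_exit n ({1..n} - T))"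

text \<open>A set of one or two vertices is \<open>{u, v}\<close> with \<open>u = v\<close> allowed,
  so four vertices describe a pair.\<close>

lemma cut_pairs_bound: "finite (cut_pairs n)" "card (cut_pairs n) \<le> n ^ 4"
proof -
  let ?V = "{1..n}"
  let ?f = "\<lambda>((u, v), (x, y)). ({u, v}, {x, y})"
  have small: "\<exists>u\<in>?V. \<exists>v\<in>?V. S = {u, v}" if S: "S \<subseteq> ?V" "card S \<in> {1, 2}" for S
  proof -
    obtain u v where "S = {u, v}"
      using S(2) by (auto simp: card_1_singleton_iff card_2_iff)
    with S(1) show ?thesis by blast
  qed
  have sub: "cut_pairs n \<subseteq> ?f ` ((?V \<times> ?V) \<times> (?V \<times> ?V))"
  proof
    fix z assume "z \<in> cut_pairs n"
    then obtain S T where z: "z = (S, T)" "S \<subseteq> ?V" "T \<subseteq> ?V" "card S \<in> {1, 2}" "card T \<in> {1, 2}"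
      by (auto simp: cut_pairs_def)
    obtain u v where "u \<in> ?V" "v \<in> ?V" "S = {u, v}" using small z by blast
    moreover obtain x y where "x \<in> ?V" "y \<in> ?V" "T = {x, y}" using small z by blast
    ultimately show "z \<in> ?f ` ((?V \<times> ?V) \<times> (?V \<times> ?V))"
      unfolding z by (intro image_eqI[of _ _ "((u, v), (x, y))"]) auto
  qed
  then show "finite (cut_pairs n)"
    by (rule finite_subset) auto
  have "card (cut_pairs n) \<le> card ((?V \<times> ?V) \<times> (?V \<times> ?V))"
    using sub by (rule surj_card_le[rotated]) auto
  then show "card (cut_pairs n) \<le> n ^ 4"
    by (simp add: card_cartesian_product numeral_eq_Suc mult.assoc)
qed

lemma prob_exceptional_le:
  assumes p: "p \<in> {0..1}" and n: "6 \<le> n"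
  shows "measure_pmf.prob (random_digraph_pmf n p) (exceptional n)
    \<le> cut_weight (1 - p / 2) 3 n + real n ^ 4 * (1 - p / 2) ^ (3 * n - 12)"
proof -
  let ?P = "measure_pmf.prob (random_digraph_pmf n p)"
  let ?E = "\<lambda>(S, T). no_exit n S \<inter> no_exit n ({1..n} - T)"
  have one: "?P (?E z) \<le> (1 - p / 2) ^ (3 * n - 12)" if "z \<in> cut_pairs n" for z
  proof -
    obtain S T where z: "z = (S, T)" "S \<subseteq> {1..n}" "T \<subseteq> {1..n}" "card S \<in> {1, 2}" "card T \<in> {1, 2}"
      "3 \<le> card S + card T"
      using \<open>z \<in> cut_pairs n\<close> by (auto simp: cut_pairs_def)
    have "?P (?E z) \<le> (1 - p / 2) ^ (card S * (n - card S) + card T * (n - card T) - card S * card T)"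
      unfolding z prod.case using p z(2,3) by (rule prob_no_exit_Int_no_exit_le)
    \<comment> \<open>Sizes 1 and 2 (in either order) give the exponent \<open>3 * n - 7\<close>,
      sizes 2 and 2 give \<open>4 * n - 12\<close>; both are at least
      \<open>3 * n - 12\<close>.\<close>
    also have "\<dots> \<le> (1 - p / 2) ^ (3 * n - 12)"
      using p z n by (intro power_decreasing) auto
    finally show ?thesis .
  qed
  have "?P (\<Union> (?E ` cut_pairs n)) \<le> (\<Sum>z\<in>cut_pairs n. ?P (?E z))"
    by (intro measure_pmf.finite_measure_subadditive_finite cut_pairs_bound) auto
  also have "\<dots> \<le> (\<Sum>z\<in>cut_pairs n. (1 - p / 2) ^ (3 * n - 12))"
    by (intro sum_mono one)
  also have "\<dots> \<le> real n ^ 4 * (1 - p / 2) ^ (3 * n - 12)"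
  proof -
    have "real (card (cut_pairs n)) \<le> real n ^ 4"
      using cut_pairs_bound(2)[of n] by (simp flip: of_nat_power)
    then show ?thesis
      using p by (auto intro: mult_right_mono)
  qed
  finally have "?P (\<Union> (?E ` cut_pairs n)) \<le> real n ^ 4 * (1 - p / 2) ^ (3 * n - 12)" .
  moreover have "?P (exceptional n) \<le> ?P (\<Union>S\<in>cuts 3 n. no_exit n S) + ?P (\<Union> (?E ` cut_pairs n))"
    unfolding exceptional_def by (intro measure_subadditive) auto
  ultimately show ?thesis
    using prob_Union_cuts_le[OF p, of n 3] by simp
qed

section \<open>Structure of disconnecting sets off the rare events\<close>

text \<open>Each of the two separating sets is small or has a small complement. Two small sets are
  merged by union, two large ones by intersection, and a mixed pair is forced down to a sink and a
  source.\<close>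

lemma both_disconnected_cases:
  assumes D: "pverts D = {1..n}" "parcs D \<subseteq> {1..n} \<times> {1..n}" "D \<notin> exceptional n"
    and n: "7 \<le> n" and V: "{a, s, b, t} \<subseteq> {1..n}" and dist: "distinct [a, s, b, t]"
  shows "(indicator (no_dipath s a \<inter> no_dipath t b) D :: real) =
    (\<Sum>E\<leftarrow>[no_exit n {s, t}, no_exit n ({1..n} - {a, b}),
       no_exit n {s} \<inter> no_exit n ({1..n} - {b}),
       no_exit n {t} \<inter> no_exit n ({1..n} - {a})]. indicator E D)"
proof -
  let ?V = "{1..n}"
  define out where "out S \<longleftrightarrow> D \<in> no_exit n S" for S
  define into where "into T \<longleftrightarrow> D \<in> no_exit n (?V - T)" for T
  have fin: "finite S" if "S \<subseteq> ?V" for S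
    using that finite_subset by blast
  have cut: "card S \<le> 2 \<or> n \<le> card S + 2" if "S \<subseteq> ?V" "out S" for S
  proof (rule ccontr)
    assume "\<not> ?thesis"
    with that have "S \<in> cuts 3 n" by (auto simp: cuts_def)
    with that D(3) show False by (auto simp: exceptional_def out_def)
  qed
  have pair: False if "out S" "into T" "S \<subseteq> ?V" "T \<subseteq> ?V" "card S \<in> {1, 2}" "card T \<in> {1, 2}"
      "3 \<le> card S + card T" for S T
    using that D(3) unfolding exceptional_def cut_pairs_def out_def into_def by blast
  have outD: "card S \<le> 2 \<or> card (?V - S) \<le> 2" if "S \<subseteq> ?V" "out S" for S
    using cut[OF that] card_Diff_subset[OF fin[OF that(1)] that(1)] by auto
  have ne: "a \<noteq> s" "a \<noteq> b" "a \<noteq> t" "s \<noteq> b" "s \<noteq> t" "b \<noteq> t"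
    using dist by simp_all
  have AB: "D \<in> no_dipath s a \<inter> no_dipath t b \<longleftrightarrow> (\<exists>S\<subseteq>?V. \<exists>S'\<subseteq>?V.
      s \<in> S \<and> a \<notin> S \<and> out S \<and> t \<in> S' \<and> b \<notin> S' \<and> out S')"
    using no_dipath_iff_no_exit[OF D(1,2), of s a] no_dipath_iff_no_exit[OF D(1,2), of t b] V
    unfolding out_def by auto
  \<comment> \<open>An exitless and an entryless set with together at least 3 vertices would be
    exceptional, so both are singletons.\<close>
  have source_sink: "S = {x} \<and> T = {y}"
    if "out S" "into T" "S \<subseteq> ?V" "T \<subseteq> ?V" "x \<in> S" "y \<in> T" "card S \<le> 2" "card T \<le> 2" for S T x y
  proof -
    have "card S > 0" "card T > 0"
      using that fin by (auto simp: card_gt_0_iff)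
    with pair[OF that(1-4)] that have "card S = 1" "card T = 1" by fastforce+
    with that show ?thesis by (auto simp: card_1_singleton_iff)
  qed
  have le4: "card (S \<union> S') \<le> 4" if "card S \<le> 2" "card S' \<le> 2" for S S' :: "nat set"
    using card_Un_le[of S S'] that by linarith
  have pair_eq: "U = {x, y}" if "U \<subseteq> ?V" "x \<in> U" "y \<in> U" "x \<noteq> y" "card U \<le> 2" for U x y
    using that fin[of U] card_seteq[of U "{x, y}"] by auto
  have "out {s, t} \<or> into {a, b} \<or> out {s} \<and> into {b} \<or> out {t} \<and> into {a}"
    if S: "S \<subseteq> ?V" "s \<in> S" "a \<notin> S" "out S" and S': "S' \<subseteq> ?V" "t \<in> S'" "b \<notin> S'" "out S'" for S S'
  proof -
    have into: "into (?V - S)" "into (?V - S')"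
      using S S' by (auto simp: into_def out_def double_diff)
    consider "card S \<le> 2" "card S' \<le> 2" | "card (?V - S) \<le> 2" "card (?V - S') \<le> 2"
      | "card S \<le> 2" "card (?V - S') \<le> 2" | "card S' \<le> 2" "card (?V - S) \<le> 2"
      using outD S S' by blast
    then show ?thesis
    proof cases
      case 1
      have U: "S \<union> S' \<subseteq> ?V" "out (S \<union> S')"
        using S S' no_exit_Un by (auto simp: out_def)
      \<comment> \<open>The union has at most 4 vertices and, by \<open>cut\<close>, at most 2 or at
        least \<open>n - 2\<close>; \<open>n \<ge> 7\<close> excludes the latter.\<close>
      then have "card (S \<union> S') \<le> 2"
        using cut[OF U] le4[OF 1] n by auto
      then have "S \<union> S' = {s, t}"
        using S S' U dist by (intro pair_eq) auto
      with U show ?thesis by simp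
    next
      case 2
      have U: "S \<inter> S' \<subseteq> ?V" "out (S \<inter> S')"
        using S S' no_exit_Int by (auto simp: out_def)
      \<comment> \<open>The dual of the previous case: the complement of the intersection is the
        union of two small complements.\<close>
      have eq: "?V - (S \<inter> S') = (?V - S) \<union> (?V - S')" by auto
      have "card (?V - (S \<inter> S')) = n - card (S \<inter> S')"
        using U card_Diff_subset[OF fin] by simp
      moreover have "card (?V - (S \<inter> S')) \<le> 4"
        unfolding eq by (rule le4[OF 2])
      ultimately have "card (?V - (S \<inter> S')) \<le> 2"
        using cut[OF U] n by auto
      then have "?V - (S \<inter> S') = {a, b}"
        using S S' V dist by (intro pair_eq) auto
      moreover have "into (?V - (S \<inter> S'))"
        using U by (simp add: into_def out_def double_diff)
      ultimately show ?thesis by simp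
    next
      case 3
      have "S = {s} \<and> ?V - S' = {b}"
        using S S' into V 3 by (intro source_sink) auto
      with S into show ?thesis by auto
    next
      case 4
      have "S' = {t} \<and> ?V - S = {a}"
        using S S' into V 4 by (intro source_sink) auto
      with S' into show ?thesis by auto
    qed
  qed
  then have only: "out {s, t} \<or> into {a, b} \<or> out {s} \<and> into {b} \<or> out {t} \<and> into {a}"
    if "D \<in> no_dipath s a \<inter> no_dipath t b"
    using that unfolding AB by blast
  have wit: "D \<in> no_dipath s a \<inter> no_dipath t b"
    if "S \<subseteq> ?V" "s \<in> S" "a \<notin> S" "out S" "S' \<subseteq> ?V" "t \<in> S'" "b \<notin> S'" "out S'" for S S'
    unfolding AB using that by blast
  have "D \<in> no_dipath s a \<inter> no_dipath t b" if "out {s, t}"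
    by (rule wit[of "{s, t}" "{s, t}"]) (use V ne that in blast)+
  moreover have "D \<in> no_dipath s a \<inter> no_dipath t b" if "into {a, b}"
    by (rule wit[of "?V - {a, b}" "?V - {a, b}"]) (use V ne that in \<open>unfold into_def out_def, blast\<close>)+
  moreover have "D \<in> no_dipath s a \<inter> no_dipath t b" if "out {s}" "into {b}"
    by (rule wit[of "{s}" "?V - {b}"]) (use V ne that in \<open>unfold into_def out_def, blast\<close>)+
  moreover have "D \<in> no_dipath s a \<inter> no_dipath t b" if "out {t}" "into {a}"
    by (rule wit[of "?V - {a}" "{t}"]) (use V ne that in \<open>unfold into_def out_def, blast\<close>)+
  ultimately have main: "D \<in> no_dipath s a \<inter> no_dipath t b \<longleftrightarrow>
      out {s, t} \<or> into {a, b} \<or> out {s} \<and> into {b} \<or> out {t} \<and> into {a}"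
    using only by blast
  \<comment> \<open>Disjointness of the four events: each listed pair has total size at least 3. The
    two sink-source events cannot coincide either, since together they give
    \<open>out {s, t}\<close> alongside \<open>into {b}\<close>.\<close>
  have "\<not> (out {s, t} \<and> into {a, b})" "\<not> (out {s, t} \<and> into {b})" "\<not> (out {s, t} \<and> into {a})"
    "\<not> (out {s} \<and> into {a, b})" "\<not> (out {t} \<and> into {a, b})"
    using pair[of "{s, t}" "{a, b}"] pair[of "{s, t}" "{b}"] pair[of "{s, t}" "{a}"]
      pair[of "{s}" "{a, b}"] pair[of "{t}" "{a, b}"] V ne by auto
  moreover have "out {s} \<and> out {t} \<longrightarrow> out {s, t}"
    using no_exit_Un[of D n "{s}" "{t}"] by (simp add: out_def insert_commute)
  ultimately have "(of_bool (D \<in> no_dipath s a \<inter> no_dipath t b) :: real) =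
      of_bool (out {s, t}) + of_bool (into {a, b}) + of_bool (out {s} \<and> into {b}) + of_bool (out {t} \<and> into {a})"
    unfolding main by (cases "out {s, t}"; cases "into {a, b}"; cases "out {s}"; cases "out {t}") simp_all
  then show ?thesis
    by (simp add: indicator_def out_def into_def)
qed

text \<open>The same analysis for one pair of vertices, with separating sets of size at most 1 or
  their complements. Excluding the joint sink-source event makes the two remaining events
  disjoint.\<close>

lemma disconnected_cases:
  assumes D: "pverts D = {1..n}" "parcs D \<subseteq> {1..n} \<times> {1..n}" "D \<notin> (\<Union>S\<in>cuts 2 n. no_exit n S)"
      "D \<notin> no_exit n {u} \<inter> no_exit n ({1..n} - {v})"
    and V: "{u, v} \<subseteq> {1..n}" "u \<noteq> v"
  shows "(indicator (no_dipath u v) D :: real) =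
    (\<Sum>E\<leftarrow>[no_exit n {u}, no_exit n ({1..n} - {v})]. indicator E D)"
proof -
  let ?V = "{1..n}"
  have A: "D \<in> no_dipath u v \<longleftrightarrow> (\<exists>S\<subseteq>?V. u \<in> S \<and> v \<notin> S \<and> D \<in> no_exit n S)"
    using no_dipath_iff_no_exit[OF D(1,2), of u v] V by auto
  have "S = {u} \<or> S = ?V - {v}" if S: "S \<subseteq> ?V" "u \<in> S" "v \<notin> S" "D \<in> no_exit n S" for S
  proof -
    have fin: "finite S" using S finite_subset by blast
    have "card S \<le> 1 \<or> card (?V - S) \<le> 1"
    proof (rule ccontr)
      assume "\<not> ?thesis"
      then have "S \<in> cuts 2 n"
        using S(1) card_Diff_subset[OF fin S(1)] by (auto simp: cuts_def)
      with S(4) D(3) show False by blast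
    qed
    then show ?thesis
    proof
      assume "card S \<le> 1"
      then have "S = {u}" using S(2) fin card_seteq[of S "{u}"] by simp
      then show ?thesis ..
    next
      assume "card (?V - S) \<le> 1"
      then have "?V - S = {v}" using S(3) V card_seteq[of "?V - S" "{v}"] by simp
      then have "S = ?V - {v}" using S(1) by blast
      then show ?thesis ..
    qed
  qed
  moreover have "{u} \<subseteq> ?V" "v \<notin> {u}" "?V - {v} \<subseteq> ?V" "u \<in> ?V - {v}"
    using V by auto
  ultimately have "D \<in> no_dipath u v \<longleftrightarrow> D \<in> no_exit n {u} \<or> D \<in> no_exit n (?V - {v})"
    unfolding A by blast
  with D(4) show ?thesis
    by (auto simp: indicator_def)
qed

section \<open>Asymptotics of the single and joint probabilities\<close>

lemma tendsto_prob_no_dipath: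
  fixes u v :: nat
  assumes p: "0 < p" "p \<le> 1" and uv: "1 \<le> u" "1 \<le> v" "u \<noteq> v"
  defines "q \<equiv> 1 - p / 2"
  shows "(\<lambda>n. measure_pmf.prob (random_digraph_pmf n p) (no_dipath u v) / q ^ n) \<longlonglongrightarrow> 2 / q"
proof -
  let ?P = "\<lambda>n. measure_pmf.prob (random_digraph_pmf n p)"
  have p': "p \<in> {0..1}" and q: "0 < q" "q < 1"
    using p by (auto simp: q_def)
  \<comment> \<open>The error after division by \<open>q ^ n\<close>: the factor 2 is the number of
    approximating events, and the second summand is the sink-source probability
    \<open>q ^ (2 * n - 3)\<close>.\<close>
  define r where "r n = 2 * (cut_weight q (Suc 1) n / q ^ (1 * n) + q ^ n / q ^ 3)" for n
  have lim: "r \<longlonglongrightarrow> 2 * (0 + 0 / q ^ 3)"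
    unfolding r_def using q
    by (intro tendsto_mult tendsto_add tendsto_divide tendsto_const tendsto_cut_weight LIMSEQ_power_zero) auto
  have bound: "norm (?P n (no_dipath u v) / q ^ n - 2 / q) \<le> r n" if n: "n \<ge> u + v + 3" for n
  proof -
    let ?V = "{1..n}"
    define pair where "pair = no_exit n {u} \<inter> no_exit n (?V - {v})"
    define N where "N = (\<Union>S\<in>cuts 2 n. no_exit n S) \<union> pair"
    have uV: "u \<in> ?V" and vV: "v \<in> ?V" using n uv by auto
    have "\<bar>?P n (no_dipath u v) - (\<Sum>E\<leftarrow>[no_exit n {u}, no_exit n (?V - {v})]. ?P n E)\<bar>
        \<le> real (length [no_exit n {u}, no_exit n (?V - {v})]) * ?P n N"
    proof (rule prob_approx_sum_list)
      fix D assume "D \<in> set_pmf (random_digraph_pmf n p)" "D \<notin> N"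
      then show "(indicator (no_dipath u v) D :: real) =
          (\<Sum>E\<leftarrow>[no_exit n {u}, no_exit n (?V - {v})]. indicator E D)"
        unfolding N_def pair_def using set_random_digraph_pmf[of D n p] uV vV uv(3)
        by (intro disconnected_cases) auto
    qed simp
    moreover have "?P n (no_exit n {u}) = q ^ (n - 1)" "?P n (no_exit n (?V - {v})) = q ^ (n - 1)"
    proof -
      have "card ({Suc 0..n} - {v}) = n - 1" using vV by simp
      moreover have "n - (n - 1) = 1" using n by simp
      ultimately show "?P n (no_exit n {u}) = q ^ (n - 1)" "?P n (no_exit n (?V - {v})) = q ^ (n - 1)"
        using prob_no_exit[OF p', of "{u}" n] prob_no_exit[OF p', of "?V - {v}" n] uV
        by (simp_all add: q_def)
    qed
    ultimately have "\<bar>?P n (no_dipath u v) - 2 * q ^ (n - 1)\<bar> \<le> 2 * ?P n N"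
      by simp
    also have "?P n N \<le> cut_weight q 2 n + q ^ (2 * n - 3)"
    proof -
      have "?P n pair = q ^ (2 * n - 3)"
        unfolding pair_def q_def using p' uV vV uv(3) by (rule prob_sink_source)
      moreover have "?P n N \<le> ?P n (\<Union>S\<in>cuts 2 n. no_exit n S) + ?P n pair"
        unfolding N_def by (intro measure_subadditive) auto
      moreover have "?P n (\<Union>S\<in>cuts 2 n. no_exit n S) \<le> cut_weight q 2 n"
        unfolding q_def using p' by (rule prob_Union_cuts_le)
      ultimately show ?thesis by linarith
    qed
    finally have *: "\<bar>?P n (no_dipath u v) - 2 * q ^ (n - 1)\<bar> \<le> 2 * (cut_weight q 2 n + q ^ (2 * n - 3))"
      by simp
    have "2 * n - 3 + 3 = n + n" "n - 1 + 1 = n" using n by auto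
    then have pw: "q ^ (2 * n - 3) * q ^ 3 = q ^ n * q ^ n" "q ^ (n - 1) * q = q ^ n"
      using power_add[of q "2 * n - 3" 3] power_add[of q "n - 1" 1] power_add[of q n n] by auto
    have main: "q ^ (n - 1) = q ^ n / q" "q ^ (2 * n - 3) = q ^ n * q ^ n / q ^ 3"
      using pw q by (simp_all add: field_simps)
    have "norm (?P n (no_dipath u v) / q ^ n - 2 / q) = \<bar>(?P n (no_dipath u v) - 2 * q ^ (n - 1)) / q ^ n\<bar>"
      unfolding main using q by (simp add: diff_divide_distrib)
    also have "\<dots> = \<bar>?P n (no_dipath u v) - 2 * q ^ (n - 1)\<bar> / q ^ n"
      using q by (simp add: abs_divide)
    also have "\<dots> \<le> 2 * (cut_weight q 2 n + q ^ (2 * n - 3)) / q ^ n"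
      using * q by (intro divide_right_mono) auto
    also have "\<dots> = r n"
      unfolding main using q by (simp add: r_def numeral_2_eq_2 add_divide_distrib)
    finally show ?thesis .
  qed
  have "(\<lambda>n. ?P n (no_dipath u v) / q ^ n - 2 / q) \<longlonglongrightarrow> 0"
  proof (rule Lim_null_comparison)
    show "\<forall>\<^sub>F n in sequentially. norm (?P n (no_dipath u v) / q ^ n - 2 / q) \<le> r n"
      using bound by (rule eventually_sequentiallyI)
    show "r \<longlonglongrightarrow> 0"
      using lim by simp
  qed
  then show ?thesis by (rule LIM_zero_cancel)
qed

text \<open>The exits of \<open>{s, t}\<close> and the entries of \<open>{a, b}\<close> number
  \<open>2 * (n - 2)\<close> each and give \<open>2 / q ^ 4\<close>; the two sink-source events give
  \<open>2 / q ^ 3\<close>.\<close>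

lemma tendsto_prob_both_disconnected:
  fixes a s b t :: nat
  assumes p: "0 < p" "p \<le> 1" and V: "{a, s, b, t} \<subseteq> {1..}" and dist: "distinct [a, s, b, t]"
  defines "q \<equiv> 1 - p / 2"
  shows "(\<lambda>n. measure_pmf.prob (random_digraph_pmf n p) (no_dipath s a \<inter> no_dipath t b) / q ^ (2 * n))
    \<longlonglongrightarrow> 2 / q ^ 4 + 2 / q ^ 3"
proof -
  let ?P = "\<lambda>n. measure_pmf.prob (random_digraph_pmf n p)"
  let ?AB = "no_dipath s a \<inter> no_dipath t b"
  have p': "p \<in> {0..1}" and q: "0 < q" "q < 1"
    using p by (auto simp: q_def)
  \<comment> \<open>The factor 4 is the number of approximating events; the second summand is
    \<open>q ^ (3 * n - 12)\<close> divided by \<open>q ^ (2 * n)\<close>, times the bound on the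
    number of pairs.\<close>
  define r where "r n = 4 * (cut_weight q (Suc 2) n / q ^ (2 * n) + real n ^ 4 * q ^ n / q ^ 12)" for n
  have lim: "r \<longlonglongrightarrow> 4 * (0 + 0 / q ^ 12)"
    unfolding r_def using q
    by (intro tendsto_mult tendsto_add tendsto_divide tendsto_const tendsto_cut_weight
        tendsto_poly_times_geometric) auto
  have bound: "norm (?P n ?AB / q ^ (2 * n) - (2 / q ^ 4 + 2 / q ^ 3)) \<le> r n"
    if n: "n \<ge> a + s + b + t + 7" for n
  proof -
    let ?V = "{1..n}"
    have V': "{a, s, b, t} \<subseteq> ?V" using V n by auto
    define Es where "Es = [no_exit n {s, t}, no_exit n (?V - {a, b}),
       no_exit n {s} \<inter> no_exit n (?V - {b}), no_exit n {t} \<inter> no_exit n (?V - {a})]"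
    have "\<bar>?P n ?AB - (\<Sum>E\<leftarrow>Es. ?P n E)\<bar> \<le> real (length Es) * ?P n (exceptional n)"
    proof (rule prob_approx_sum_list)
      fix D assume D: "D \<in> set_pmf (random_digraph_pmf n p)" "D \<notin> exceptional n"
      show "(indicator ?AB D :: real) = (\<Sum>E\<leftarrow>Es. indicator E D)"
        unfolding Es_def
        by (rule both_disconnected_cases[OF set_random_digraph_pmf[OF D(1)] D(2) _ V' dist]) (use n in simp)
    qed (simp add: Es_def)
    moreover have "(\<Sum>E\<leftarrow>Es. ?P n E) = 2 * q ^ (2 * n - 4) + 2 * q ^ (2 * n - 3)"
    proof -
      have "card (?V - {a, b}) = n - 2" "card {s, t} = 2" "card {a, b} = 2"
        using V' dist by (auto simp: card_Diff_subset)
      moreover have "n - (n - 2) = 2" "2 * (n - 2) = 2 * n - 4" "(n - 2) * 2 = 2 * n - 4" using n by auto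
      moreover have "{s, t} \<subseteq> ?V" "?V - {a, b} \<subseteq> ?V" using V' by blast+
      ultimately have "?P n (no_exit n {s, t}) = q ^ (2 * n - 4)"
          "?P n (no_exit n (?V - {a, b})) = q ^ (2 * n - 4)"
        by (simp_all only: prob_no_exit[OF p'] q_def)
      moreover have "?P n (no_exit n {s} \<inter> no_exit n (?V - {b})) = q ^ (2 * n - 3)"
        "?P n (no_exit n {t} \<inter> no_exit n (?V - {a})) = q ^ (2 * n - 3)"
        unfolding q_def using p' V' dist by (intro prob_sink_source; simp)+
      ultimately show ?thesis by (simp add: Es_def)
    qed
    moreover have "?P n (exceptional n) \<le> cut_weight q 3 n + real n ^ 4 * q ^ (3 * n - 12)"
      unfolding q_def using p' n by (intro prob_exceptional_le) auto
    ultimately have *: "\<bar>?P n ?AB - (2 * q ^ (2 * n - 4) + 2 * q ^ (2 * n - 3))\<bar>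
        \<le> 4 * (cut_weight q 3 n + real n ^ 4 * q ^ (3 * n - 12))"
      by (simp add: Es_def)
    have pw: "q ^ i = q ^ k / q ^ l" if "i + l = k" for i k l
      using q that by (auto simp: power_add)
    have main: "q ^ (2 * n - 4) = q ^ (2 * n) / q ^ 4" "q ^ (2 * n - 3) = q ^ (2 * n) / q ^ 3"
      "q ^ (3 * n - 12) = q ^ (2 * n + n) / q ^ 12"
      using n by (intro pw; simp)+
    have "norm (?P n ?AB / q ^ (2 * n) - (2 / q ^ 4 + 2 / q ^ 3)) =
        \<bar>(?P n ?AB - (2 * q ^ (2 * n - 4) + 2 * q ^ (2 * n - 3))) / q ^ (2 * n)\<bar>"
      unfolding main using q by (simp add: diff_divide_distrib add_divide_distrib)
    also have "\<dots> = \<bar>?P n ?AB - (2 * q ^ (2 * n - 4) + 2 * q ^ (2 * n - 3))\<bar> / q ^ (2 * n)"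
      using q by (simp add: abs_divide)
    also have "\<dots> \<le> 4 * (cut_weight q 3 n + real n ^ 4 * q ^ (3 * n - 12)) / q ^ (2 * n)"
      using * q by (intro divide_right_mono) auto
    also have "\<dots> = r n"
      unfolding main power_add using q by (simp add: r_def numeral_3_eq_3 numeral_2_eq_2 add_divide_distrib)
    finally show ?thesis .
  qed
  have "(\<lambda>n. ?P n ?AB / q ^ (2 * n) - (2 / q ^ 4 + 2 / q ^ 3)) \<longlonglongrightarrow> 0"
  proof (rule Lim_null_comparison)
    show "\<forall>\<^sub>F n in sequentially. norm (?P n ?AB / q ^ (2 * n) - (2 / q ^ 4 + 2 / q ^ 3)) \<le> r n"
      using bound by (rule eventually_sequentiallyI)
    show "r \<longlonglongrightarrow> 0"
      using lim by simp
  qed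
  then show ?thesis by (rule LIM_zero_cancel)
qed

section \<open>The edgeless case and the limit\<close>

lemma prob_eq_1_if_no_edges:
  fixes a s b t :: nat
  assumes V: "{a, s, b, t} \<subseteq> {1..n}" and dist: "distinct [a, s, b, t]"
  shows "measure_pmf.prob (random_digraph_pmf n 0) (no_dipath s a \<inter> no_dipath t b) = 1"
proof -
  let ?P = "measure_pmf.prob (random_digraph_pmf n 0)"
  have "1 = ?P (no_exit n {s, t})"
    using V by (subst prob_no_exit) auto
  \<comment> \<open>Passing to the support makes the digraph well-formed, as the characterisation by
    exitless sets requires; \<open>{s, t}\<close> then blocks both paths.\<close>
  also have "\<dots> = ?P (no_exit n {s, t} \<inter> set_pmf (random_digraph_pmf n 0))"
    by (simp add: measure_Int_set_pmf)
  also have "\<dots> \<le> ?P (no_dipath s a \<inter> no_dipath t b)"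
  proof (rule measure_pmf.finite_measure_mono)
    have "D \<in> no_dipath s a \<inter> no_dipath t b"
      if D: "D \<in> no_exit n {s, t}" "D \<in> set_pmf (random_digraph_pmf n 0)" for D
    proof -
      have "{s, t} \<subseteq> {1..n}" "s \<in> {1..n}" "t \<in> {1..n}" "a \<notin> {s, t}" "b \<notin> {s, t}"
        using V dist by auto
      then show ?thesis
        using D(1) no_dipath_iff_no_exit[OF set_random_digraph_pmf[OF D(2)]] by blast
    qed
    then show "no_exit n {s, t} \<inter> set_pmf (random_digraph_pmf n 0) \<subseteq> no_dipath s a \<inter> no_dipath t b"
      by blast
  qed simp
  finally show ?thesis
    using measure_pmf.prob_le_1 by (intro antisym) auto
qed

theorem theorem3p3:
  fixes p :: real and a s b t :: nat
  assumes p: "p \<in> {0..1}"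
    and distinct: "distinct [a, s, b, t]"
    and vertices: "{a, s, b, t} \<subseteq> {1..}"
  defines "P \<equiv> \<lambda>n. measure_pmf.prob (random_digraph_pmf n p)"
    and "A \<equiv> no_dipath s a"
    and "B \<equiv> no_dipath t b"
  shows "(\<lambda>n. (P n (A \<inter> B) - P n A * P n B) / P n (A \<inter> B))
           \<longlonglongrightarrow> p * (3 - p) / (4 - p)"
\<comment> \<open>For \<open>p = 0\<close> there is no decay (\<open>q = 1\<close>), so the
  asymptotics do not apply; instead all three probabilities are eventually 1 and the quotient is
  0.\<close>
proof (cases "p = 0")
  case True
  have "(P n (A \<inter> B) - P n A * P n B) / P n (A \<inter> B) = 0" if n: "n \<ge> a + s + b + t" for n
  proof -
    have AB: "P n (A \<inter> B) = 1"
      unfolding P_def A_def B_def True using vertices n distinct by (intro prob_eq_1_if_no_edges) auto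
    have "P n (A \<inter> B) \<le> P n A" "P n (A \<inter> B) \<le> P n B"
      unfolding P_def by (auto intro!: measure_pmf.finite_measure_mono)
    moreover have "P n A \<le> 1" "P n B \<le> 1"
      unfolding P_def by auto
    ultimately show ?thesis using AB by simp
  qed
  then have "\<forall>\<^sub>F n in sequentially. (P n (A \<inter> B) - P n A * P n B) / P n (A \<inter> B) = 0"
    by (rule eventually_sequentiallyI)
  then show ?thesis
    unfolding True by (simp add: tendsto_eventually)
next
  case False
  with p have p': "0 < p" "p \<le> 1" by auto
  define q where "q = 1 - p / 2"
  have q: "0 < q" "q < 1" and pq: "p = 2 * (1 - q)" using p' by (auto simp: q_def)
  \<comment> \<open>Every probability is divided by its own decay rate; the powers of
    \<open>q\<close> cancel, so \<open>f\<close> eventually equals the quotient while all its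
    ingredients converge.\<close>
  define f where "f n = 1 - (P n A / q ^ n) * (P n B / q ^ n) / (P n (A \<inter> B) / q ^ (2 * n))" for n
  have AB: "(\<lambda>n. P n (A \<inter> B) / q ^ (2 * n)) \<longlonglongrightarrow> 2 / q ^ 4 + 2 / q ^ 3"
    unfolding P_def A_def B_def q_def using p' vertices distinct by (rule tendsto_prob_both_disconnected)
  have pos: "2 / q ^ 4 + 2 / q ^ 3 > 0"
    using q by (intro add_pos_pos) auto
  have A: "(\<lambda>n. P n A / q ^ n) \<longlonglongrightarrow> 2 / q" and B: "(\<lambda>n. P n B / q ^ n) \<longlonglongrightarrow> 2 / q"
    unfolding P_def A_def B_def q_def
    using p' vertices distinct by (intro tendsto_prob_no_dipath; simp)+
  have "f \<longlonglongrightarrow> 1 - (2 / q) * (2 / q) / (2 / q ^ 4 + 2 / q ^ 3)"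
    unfolding f_def using pos by (intro tendsto_diff tendsto_const tendsto_divide tendsto_mult A B AB) auto
  also have "1 - (2 / q) * (2 / q) / (2 / q ^ 4 + 2 / q ^ 3) = p * (3 - p) / (4 - p)"
  proof -
    define c where "c = 1 + q"
    have c: "c \<noteq> 0" using q by (simp add: c_def)
    have "2 / q ^ 4 + 2 / q ^ 3 = 2 * c / q ^ 4"
      using q by (simp add: c_def field_simps eval_nat_numeral)
    then have "(2 / q) * (2 / q) / (2 / q ^ 4 + 2 / q ^ 3) = 2 * q ^ 2 / (1 + q)"
      unfolding c_def[symmetric] using q c by (simp add: field_simps eval_nat_numeral)
    \<comment> \<open>Here \<open>1 + q - 2 * q ^ 2 = (1 - q) * (1 + 2 * q)\<close>, with
      \<open>1 - q = p / 2\<close>, \<open>1 + 2 * q = 3 - p\<close> and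
      \<open>1 + q = (4 - p) / 2\<close>.\<close>
    moreover have "1 - 2 * q ^ 2 / (1 + q) = p * (3 - p) / (4 - p)"
      using q unfolding pq by (simp add: field_simps power2_eq_square)
    ultimately show ?thesis by simp
  qed
  finally have "f \<longlonglongrightarrow> p * (3 - p) / (4 - p)" .
  moreover have "\<forall>\<^sub>F n in sequentially. f n = (P n (A \<inter> B) - P n A * P n B) / P n (A \<inter> B)"
    \<comment> \<open>The positive limit makes \<open>P n (A \<inter> B)\<close> eventually nonzero,
      which permits clearing denominators.\<close>
    using order_tendstoD(1)[OF AB pos]
  proof eventually_elim
    case (elim n)
    then have "P n (A \<inter> B) \<noteq> 0" by auto
    then show ?case
      using q by (simp add: f_def field_simps power_mult power2_eq_square flip: power_add)
  qed
  ultimately show ?thesis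
    by (rule Lim_transform_eventually)
qed

end
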